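(* Let $S$ be an inverse semigroup. The following congruences of $S$ are equal: (1) the center of $S$ in the sense of universal algebra, i.e. the largest congruence of $S$ that centralizes $1_S=S\times S$ (in particular, such a largest congruence exists); (2) $\ker(\Psi)=\{(g,h)\in S\times S\mid \psi_g=\psi_h\}$; (3) $\ker(\Phi)=\{(g,h)\in S\times S\mid \phi_g=\phi_h\}$; (4) $\mathcal{H}\cap\{(a,b)\in S\times S\mid axb=bxa \text{ for all } x\in S\}$. The corresponding congruence pair is $(Z(S),0_{E(S)})$, where $Z(S)=\{a\in S\mid axa^{-1}a=aa^{-1}xa\text{ for all }x\in S\}$; that is, this congruence has kernel $Z(S)$ and its trace is the equality relation on $E(S)$.
   Context: An inverse semigroup $S$ is a semigroup in which every $x$ has a unique inverse $x^{-1}$ with $xx^{-1}x=x$ and $x^{-1}xx^{-1}=x^{-1}$; it is viewed as an algebra $(S,\cdot,{}^{-1})$. $E(S)$ is the semilattice of idempotents and $0_{E(S)}$ is the equality relation on $E(S)$. A congruence of $S$ is an equivalence relation compatible with multiplication and inversion. The kernel of a congruence $\alpha$ (as a subset of $S$) is the union of all $\alpha$-classes containing idempotents; its trace is the restriction of $\alpha$ to $E(S)$; its congruence pair is (kernel, trace). Green's relation $\mathcal{H}$ on $S$: $a\,\mathcal{H}\,b$ iff $a^{-1}a=b^{-1}b$ and $aa^{-1}=bb^{-1}$. For $g\in S$, $\psi_g:S\to S$ is the total map $x\mapsto gxg^{-1}$, and $\Psi:S\to T_S$, $g\mapsto\psi_g$, maps into the monoid $T_S$ of all total transformations of $S$.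 For $g\in S$, $\phi_g: g^{-1}Sg\to gSg^{-1}$ is the partial map of $S$ given by $x\mapsto gxg^{-1}$; it is an isomorphism between inverse subsemigroups of $S$. $\Phi:S\to\mathrm{PAut}(S)$, $g\mapsto\phi_g$, maps into the inverse monoid $\mathrm{PAut}(S)$ of partial automorphisms of $S$ (isomorphisms between inverse subsemigroups of $S$). Two partial maps are equal iff they have the same domain and the same values on it. For congruences $\alpha,\beta$ of $S$ and an $(n+1)$-ary term $t$ ($n\ge 1$) in the language $\{\cdot,{}^{-1}\}$, the term condition $\mathrm{TC}(t,\alpha,\beta)$ says: for all $a\,\alpha\,b$ and all $u_i\,\beta\,v_i$ ($1\le i\le n$), $t(a,u_1,\dots,u_n)=t(a,v_1,\dots,v_n)$ implies $t(b,u_1,\dots,u_n)=t(b,v_1,\dots,v_n)$. We say $\alpha$ centralizes $\beta$ if $\mathrm{TC}(t,\alpha,\beta)$ holds for every term $t$ of arity $\ge 2$. *)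

theory Defs imports Main begin

unbundle no converse_syntax

class inverse_semigroup = semigroup_mult +
  fixes sinv :: "'a \<Rightarrow> 'a"  ("_\<inverse>" [1000] 999)
  assumes mult_sinv_mult: "x * x\<inverse> * x = x"
    and sinv_mult_sinv: "x\<inverse> * x * x\<inverse> = x\<inverse>"
    and sinv_unique: "x * y * x = x \<Longrightarrow> y * x * y = y \<Longrightarrow> y = x\<inverse>"

definition idempotents :: "'a::inverse_semigroup set" where
  "idempotents = {e. e * e = e}"

definition congruence :: "('a::inverse_semigroup) rel \<Rightarrow> bool" where
  "congruence \<alpha> \<longleftrightarrow> equiv UNIV \<alpha> \<and>
     (\<forall>a b c d. (a, b) \<in> \<alpha> \<and> (c, d) \<in> \<alpha> \<longrightarrow> (a * c, b * d) \<in> \<alpha>) \<and>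
     (\<forall>a b. (a, b) \<in> \<alpha> \<longrightarrow> (a\<inverse>, b\<inverse>) \<in> \<alpha>)"

definition congruence_kernel :: "('a::inverse_semigroup) rel \<Rightarrow> 'a set" where
  "congruence_kernel \<alpha> = \<Union> {C \<in> UNIV // \<alpha>. C \<inter> idempotents \<noteq> {}}"

definition congruence_trace :: "('a::inverse_semigroup) rel \<Rightarrow> 'a rel" where
  "congruence_trace \<alpha> = \<alpha> \<inter> idempotents \<times> idempotents"

definition congruence_pair :: "('a::inverse_semigroup) rel \<Rightarrow> 'a set \<times> 'a rel" where
  "congruence_pair \<alpha> = (congruence_kernel \<alpha>, congruence_trace \<alpha>)"

definition green_H :: "('a::inverse_semigroup) rel" where
  "green_H = {(a, b). a\<inverse> * a = b\<inverse> * b \<and> a * a\<inverse> = b * b\<inverse>}"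

definition psi :: "'a::inverse_semigroup \<Rightarrow> 'a \<Rightarrow> 'a" where
  "psi g = (\<lambda>x. g * x * g\<inverse>)"

definition phi :: "'a::inverse_semigroup \<Rightarrow> 'a \<rightharpoonup> 'a" where
  "phi g = (\<lambda>x. if x \<in> range (\<lambda>s. g\<inverse> * s * g) then Some (g * x * g\<inverse>) else None)"

definition map_kernel :: "('a \<Rightarrow> 'b) \<Rightarrow> 'a rel" where
  "map_kernel f = {(g, h). f g = f h}"

datatype (vars: 'v) sterm = Var 'v | Mult "'v sterm" "'v sterm" | Inv "'v sterm"

primrec eval_sterm :: "'a::inverse_semigroup list \<Rightarrow> nat sterm \<Rightarrow> 'a" where
  "eval_sterm xs (Var i) = xs ! i"
| "eval_sterm xs (Mult s t) = eval_sterm xs s * eval_sterm xs t"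
| "eval_sterm xs (Inv t) = (eval_sterm xs t)\<inverse>"

text \<open>A \<open>k\<close>-ary term is one whose variables are among the indices \<open>0, \<dots>, k - 1\<close>; not all of
  them need to occur. It is evaluated at argument lists of length \<open>k\<close>.\<close>

definition term_of_arity :: "nat \<Rightarrow> nat sterm \<Rightarrow> bool" where
  "term_of_arity k t \<longleftrightarrow> vars t \<subseteq> {..<k}"

text \<open>In \<open>term_condition n t \<alpha> \<beta>\<close> the term \<open>t\<close> is understood to be \<open>(n + 1)\<close>-ary.\<close>

definition term_condition ::
    "nat \<Rightarrow> nat sterm \<Rightarrow> ('a::inverse_semigroup) rel \<Rightarrow> 'a rel \<Rightarrow> bool" where
  "term_condition n t \<alpha> \<beta> \<longleftrightarrow>
     (\<forall>a b us vs. (a, b) \<in> \<alpha> \<longrightarrow> length us = n \<longrightarrow> length vs = n \<longrightarrow>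
        (\<forall>i<n. (us ! i, vs ! i) \<in> \<beta>) \<longrightarrow>
        eval_sterm (a # us) t = eval_sterm (a # vs) t \<longrightarrow>
        eval_sterm (b # us) t = eval_sterm (b # vs) t)"

definition centralizes :: "('a::inverse_semigroup) rel \<Rightarrow> 'a rel \<Rightarrow> bool" where
  "centralizes \<alpha> \<beta> \<longleftrightarrow>
     (\<forall>n\<ge>1. \<forall>t. term_of_arity (n + 1) t \<longrightarrow> term_condition n t \<alpha> \<beta>)"

text \<open>Being a greatest element, a center is unique if it exists.\<close>

definition is_center :: "('a::inverse_semigroup) rel \<Rightarrow> bool" where
  "is_center \<zeta> \<longleftrightarrow> congruence \<zeta> \<and> centralizes \<zeta> UNIV \<and>
     (\<forall>\<alpha>. congruence \<alpha> \<and> centralizes \<alpha> UNIV \<longrightarrow> \<alpha> \<subseteq> \<zeta>)"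

definition Z_set :: "'a::inverse_semigroup set" where
  "Z_set = {a. \<forall>x. a * x * a\<inverse> * a = a * a\<inverse> * x * a}"

end

(* For a pair (a, b) in the relation (4), the identity a x b = b x a propagates to terms:
   t(a,v) z t(b,u) = t(b,v) z t(a,u). If moreover t(a,u) = t(a,v) = w, then choosing z to be the
   inverse of w turns this into t(b,u) = t(b,v), because w, t(b,u) and t(b,v) are H-related.
   Conversely, the term condition for a centralizing congruence alpha, applied to the term x u,
   shows that alpha separates idempotents, hence is contained in H; applied to the term u x v, it
   turns the equality of the two bracketings of a x a into a x b = b x a. *)

theory Submission imports Defs begin

section \<open>Inverses and commuting idempotents\<close>

context inverse_semigroup
begin

lemma mult_sinv_mult_left [simp]: "x * (x\<inverse> * x) = x"
  using mult_sinv_mult by (simp add: mult.assoc)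

lemma sinv_mult_sinv_left [simp]: "x\<inverse> * (x * x\<inverse>) = x\<inverse>"
  using sinv_mult_sinv by (simp add: mult.assoc)

text \<open>Products are normalised to right-nested form by \<open>mult.assoc\<close>, so the
  cancellation laws also need versions with a trailing factor.\<close>

lemma mult_sinv_mult_cancel [simp]: "x * (x\<inverse> * (x * y)) = x * y"
  using mult_sinv_mult by (metis mult.assoc)

lemma sinv_mult_sinv_cancel [simp]: "x\<inverse> * (x * (x\<inverse> * y)) = x\<inverse> * y"
  using sinv_mult_sinv by (metis mult.assoc)

lemma sinv_sinv [simp]: "(x\<inverse>)\<inverse> = x"
  using sinv_unique[of "x\<inverse>" x] by (simp add: mult.assoc)

lemma sinv_idem: "e * e = e \<Longrightarrow> e\<inverse> = e"
  using sinv_unique[of e e] by simp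

text \<open>If \<open>x\<close> is the inverse of \<open>e * f\<close>, then
  \<open>f * x * e\<close> is idempotent and also an inverse of \<open>e * f\<close>. By uniqueness
  it is \<open>x\<close>; so \<open>x\<close> is idempotent, hence its own inverse, which is
  \<open>e * f\<close>.\<close>

lemma idem_mult_idem:
  assumes e: "e * e = e" and f: "f * f = f"
  shows "(e * f) * (e * f) = e * f"
proof -
  define x where "x = (e * f)\<inverse>"
  have x1: "e * f * x * (e * f) = e * f" and x2: "x * (e * f) * x = x"
    unfolding x_def by (rule mult_sinv_mult, rule sinv_mult_sinv)
  have "(e * f) * (f * x * e) * (e * f) = e * f"
    using e f x1 by (metis mult.assoc)
  moreover have idem: "(f * x * e) * (f * x * e) = f * x * e"
    using x2 by (metis mult.assoc)
  moreover have "(f * x * e) * (e * f) * (f * x * e) = f * x * e"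
    using e f idem by (metis mult.assoc)
  ultimately have "x = f * x * e"
    unfolding x_def by (metis sinv_unique)
  with idem have "x * x = x"
    by simp
  then have "x\<inverse> = x"
    by (rule sinv_idem)
  then have "x = e * f"
    unfolding x_def by simp
  with \<open>x * x = x\<close> show ?thesis
    by simp
qed

text \<open>Both products are idempotent, so \<open>f * e\<close> is an inverse of
  \<open>e * f\<close>, while an idempotent is its own inverse.\<close>

lemma idem_commute:
  assumes e: "e * e = e" and f: "f * f = f"
  shows "e * f = f * e"
proof -
  note ef = idem_mult_idem[OF e f] and fe = idem_mult_idem[OF f e]
  have "(e * f) * (f * e) * (e * f) = e * f"
    using e f ef by (metis mult.assoc)
  moreover have "(f * e) * (e * f) * (f * e) = f * e"
    using e f fe by (metis mult.assoc)
  ultimately have "f * e = (e * f)\<inverse>"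
    by (rule sinv_unique)
  with sinv_idem[OF ef] show ?thesis
    by simp
qed

lemma sinv_mult_idem: "(x\<inverse> * x) * (x\<inverse> * x) = x\<inverse> * x"
  by (simp add: mult.assoc)

lemma mult_sinv_idem: "(x * x\<inverse>) * (x * x\<inverse>) = x * x\<inverse>"
  by (simp add: mult.assoc)

lemma sinv_mult [simp]: "(x * y)\<inverse> = y\<inverse> * x\<inverse>"
proof -
  have comm: "y * y\<inverse> * (x\<inverse> * x) = x\<inverse> * x * (y * y\<inverse>)"
    by (rule idem_commute[OF mult_sinv_idem sinv_mult_idem])
  have "(x * y) * (y\<inverse> * x\<inverse>) * (x * y) = x * (y * y\<inverse> * (x\<inverse> * x)) * y"
    by (simp add: mult.assoc)
  also have "\<dots> = x * y"
    unfolding comm by (simp add: mult.assoc)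
  finally have 1: "(x * y) * (y\<inverse> * x\<inverse>) * (x * y) = x * y" .
  have "(y\<inverse> * x\<inverse>) * (x * y) * (y\<inverse> * x\<inverse>) = y\<inverse> * (x\<inverse> * x * (y * y\<inverse>)) * x\<inverse>"
    by (simp add: mult.assoc)
  also have "\<dots> = y\<inverse> * x\<inverse>"
    unfolding comm[symmetric] by (simp add: mult.assoc)
  finally have 2: "(y\<inverse> * x\<inverse>) * (x * y) * (y\<inverse> * x\<inverse>) = y\<inverse> * x\<inverse>" .
  show ?thesis
    using sinv_unique[OF 1 2] by simp
qed

end

section \<open>The relation (4) and Green's relation H\<close>

definition swap_rel :: "('a::inverse_semigroup) rel" where
  "swap_rel = green_H \<inter> {(a, b). \<forall>x. a * x * b = b * x * a}"

lemma green_HD: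
  assumes "(a, b) \<in> green_H"
  shows "a\<inverse> * a = b\<inverse> * b" "a * a\<inverse> = b * b\<inverse>"
  using assms by (auto simp: green_H_def)

lemma green_H_absorb:
  assumes "(a, b) \<in> green_H"
  shows "a * a\<inverse> * b = b" "b * (a\<inverse> * a) = b"
  using green_HD[OF assms] by (simp_all add: mult.assoc)

lemma green_H_sym: "(a, b) \<in> green_H \<Longrightarrow> (b, a) \<in> green_H"
  by (simp add: green_H_def)

lemma green_H_idem_eq:
  assumes "(e, f) \<in> green_H" "e * e = e" "f * f = f"
  shows "e = f"
  using green_HD(1)[OF assms(1)] assms(2,3) by (simp add: sinv_idem)

lemma swap_relD:
  assumes "(a, b) \<in> swap_rel"
  shows "(a, b) \<in> green_H" "a * x * b = b * x * a"
  using assms by (auto simp: swap_rel_def)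

section \<open>The relation (4) is the kernel of \<open>psi\<close>\<close>

lemma swap_rel_psi_eq:
  assumes "(a, b) \<in> swap_rel"
  shows "psi a = psi b"
proof
  fix x
  note H = swap_relD(1)[OF assms]
  \<comment> \<open>The factor \<open>b * b\<inverse>\<close>, equal to
    \<open>a * a\<inverse>\<close>, is inserted to create a \<open>b\<close> to swap with
    \<open>a\<close> around \<open>x * a\<inverse>\<close>.\<close>
  have "a * x * a\<inverse> = a * (x * a\<inverse>) * b * b\<inverse>"
    by (metis green_HD(2)[OF H] mult.assoc sinv_mult_sinv)
  also have "\<dots> = b * (x * a\<inverse>) * a * b\<inverse>"
    by (simp only: swap_relD(2)[OF assms])
  also have "\<dots> = b * x * b\<inverse>"
    by (metis green_HD(1)[OF H] mult.assoc sinv_mult_sinv)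
  finally show "psi a x = psi b x"
    by (simp add: psi_def)
qed

lemma psi_eq_left_idem:
  assumes "psi a = psi b"
  shows "b * (a\<inverse> * a) * b\<inverse> = a * a\<inverse>"
  using fun_cong[OF assms, of "a\<inverse> * a"] by (simp add: psi_def mult.assoc)

text \<open>Each range idempotent is a conjugate by the other element, hence absorbed by the other's
  range idempotent. As idempotents commute, mutual absorption is equality.\<close>

lemma psi_eq_range_idem:
  assumes "psi a = psi b"
  shows "a * a\<inverse> = b * b\<inverse>"
proof -
  have absorb: "c * c\<inverse> * (d * d\<inverse>) = d * d\<inverse>" if "psi c = psi d" for c d :: 'a
  proof -
    have "c * c\<inverse> * (d * d\<inverse>) = c * c\<inverse> * (c * (d\<inverse> * d) * c\<inverse>)"
      using psi_eq_left_idem[OF that[symmetric]] by simp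
    also have "\<dots> = c * (d\<inverse> * d) * c\<inverse>"
      by (simp add: mult.assoc)
    also have "\<dots> = d * d\<inverse>"
      by (rule psi_eq_left_idem[OF that[symmetric]])
    finally show ?thesis .
  qed
  show ?thesis
    using absorb[OF assms] absorb[OF assms[symmetric]]
      idem_commute[OF mult_sinv_idem mult_sinv_idem, of a b] by simp
qed

text \<open>Again mutual absorption: commuting \<open>c\<inverse> * c\<close> past
  \<open>d\<inverse> * d\<close> turns \<open>d * (c\<inverse> * c)\<close> into
  \<open>c * c\<inverse> * d\<close>, which is \<open>d\<close> because the range idempotents
  agree.\<close>

lemma psi_eq_domain_idem:
  assumes "psi a = psi b"
  shows "a\<inverse> * a = b\<inverse> * b"
proof -
  have absorb: "d\<inverse> * d * (c\<inverse> * c) = d\<inverse> * d" if "psi c = psi d" for c d :: 'a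
  proof -
    have "d * (c\<inverse> * c) = d * (d\<inverse> * d * (c\<inverse> * c))"
      by (simp add: mult.assoc)
    also have "\<dots> = d * (c\<inverse> * c) * d\<inverse> * d"
      using idem_commute[OF sinv_mult_idem sinv_mult_idem, of d c] by (simp add: mult.assoc)
    also have "\<dots> = d"
      using psi_eq_left_idem[OF that] psi_eq_range_idem[OF that] by (simp add: mult.assoc)
    finally show ?thesis
      by (simp add: mult.assoc)
  qed
  show ?thesis
    using absorb[OF assms] absorb[OF assms[symmetric]]
      idem_commute[OF sinv_mult_idem sinv_mult_idem, of a b] by simp
qed

lemma psi_eq_green_H:
  assumes "psi a = psi b"
  shows "(a, b) \<in> green_H"
  using psi_eq_range_idem[OF assms] psi_eq_domain_idem[OF assms] by (simp add: green_H_def)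

text \<open>H-relatedness gives \<open>b = b * a\<inverse> * a\<close>, which exhibits
  \<open>a * x * b\<close> as \<open>psi a (x * b) * a\<close>; replacing \<open>psi a\<close> by
  \<open>psi b\<close> leaves \<open>b * b\<inverse>\<close> to be absorbed by
  \<open>a\<close>.\<close>

lemma psi_eq_swap_rel:
  assumes "psi a = psi b"
  shows "(a, b) \<in> swap_rel"
proof -
  note H = psi_eq_green_H[OF assms]
  have "a * x * b = b * x * a" for x
  proof -
    have "a * x * b = a * (x * b) * a\<inverse> * a"
      using green_H_absorb(2)[OF H] by (simp add: mult.assoc)
    also have "\<dots> = b * (x * b) * b\<inverse> * a"
      using fun_cong[OF assms, of "x * b"] by (simp add: psi_def)
    also have "\<dots> = b * x * a"
      using green_H_absorb(1)[OF green_H_sym[OF H]] by (simp add: mult.assoc)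
    finally show ?thesis .
  qed
  with H show ?thesis
    by (simp add: swap_rel_def)
qed

lemma swap_rel_iff_psi: "(a, b) \<in> swap_rel \<longleftrightarrow> psi a = psi b"
  using swap_rel_psi_eq psi_eq_swap_rel by blast

section \<open>The kernels of \<open>psi\<close> and \<open>phi\<close> agree\<close>

text \<open>This writes the domain of \<open>phi g\<close> as \<open>e S e\<close> with
  \<open>e = g\<inverse> * g\<close>, so that it depends on \<open>g\<close> only through that
  idempotent.\<close>

lemma range_sinv_conj:
  fixes g :: "'a::inverse_semigroup"
  shows "range (\<lambda>s. g\<inverse> * s * g) = range (\<lambda>s. g\<inverse> * g * s * (g\<inverse> * g))"
proof (intro equalityI subsetI)
  fix y assume "y \<in> range (\<lambda>s. g\<inverse> * s * g)"
  then obtain s where "y = g\<inverse> * s * g"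
    by blast
  then have "y = g\<inverse> * g * (g\<inverse> * s * g) * (g\<inverse> * g)"
    by (simp add: mult.assoc)
  then show "y \<in> range (\<lambda>s. g\<inverse> * g * s * (g\<inverse> * g))"
    by blast
next
  fix y assume "y \<in> range (\<lambda>s. g\<inverse> * g * s * (g\<inverse> * g))"
  then obtain s where "y = g\<inverse> * g * s * (g\<inverse> * g)"
    by blast
  then have "y = g\<inverse> * (g * s * g\<inverse>) * g"
    by (simp add: mult.assoc)
  then show "y \<in> range (\<lambda>s. g\<inverse> * s * g)"
    by blast
qed

lemma psi_eq_phi_eq:
  assumes "psi g = psi h"
  shows "phi g = phi h"
proof -
  have "range (\<lambda>s. g\<inverse> * s * g) = range (\<lambda>s. h\<inverse> * s * h)"
    unfolding range_sinv_conj psi_eq_domain_idem[OF assms] ..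
  moreover have "g * x * g\<inverse> = h * x * h\<inverse>" for x
    using fun_cong[OF assms, of x] by (simp add: psi_def)
  ultimately show ?thesis
    by (simp add: phi_def cong: if_cong)
qed

lemma dom_phi: "dom (phi g) = range (\<lambda>s. g\<inverse> * g * s * (g\<inverse> * g))"
  unfolding range_sinv_conj[symmetric] by (auto simp: phi_def dom_def)

text \<open>The idempotent \<open>g\<inverse> * g\<close> is the identity element of the domain of
  \<open>phi g\<close>, so equal domains force equal idempotents.\<close>

lemma phi_eq_psi_eq:
  assumes "phi g = phi h"
  shows "psi g = psi h"
proof -
  have absorb: "d\<inverse> * d * (c\<inverse> * c) = c\<inverse> * c" if "phi c = phi d" for c d :: 'a
  proof -
    have "c\<inverse> * c = c\<inverse> * c * (c\<inverse> * c) * (c\<inverse> * c)"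
      by (simp add: mult.assoc)
    then have "c\<inverse> * c \<in> dom (phi c)"
      unfolding dom_phi by blast
    with that have "c\<inverse> * c \<in> dom (phi d)"
      by simp
    then obtain s where s: "c\<inverse> * c = d\<inverse> * d * s * (d\<inverse> * d)"
      unfolding dom_phi by blast
    show ?thesis
      unfolding s by (simp add: mult.assoc)
  qed
  have e: "g\<inverse> * g = h\<inverse> * h"
    using absorb[OF assms] absorb[OF assms[symmetric]]
      idem_commute[OF sinv_mult_idem sinv_mult_idem, of g h] by simp
  have "g * x * g\<inverse> = h * x * h\<inverse>" for x
  proof -
    \<comment> \<open>Compressing \<open>x\<close> by the common idempotent moves it into the domain
      without changing its conjugate by \<open>g\<close> or by \<open>h\<close>.\<close>
    define y where "y = g\<inverse> * g * x * (g\<inverse> * g)"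
    have "y \<in> dom (phi g)"
      unfolding dom_phi y_def by blast
    then have y: "phi k y = Some (k * y * k\<inverse>)" if "phi k = phi g" for k
      unfolding that[symmetric] by (auto simp: phi_def split: if_splits)
    have "g * y * g\<inverse> = h * y * h\<inverse>"
      using y[OF refl] y[OF assms[symmetric]] assms by simp
    moreover have "g * y * g\<inverse> = g * x * g\<inverse>"
      unfolding y_def by (simp add: mult.assoc)
    moreover have "h * y * h\<inverse> = h * x * h\<inverse>"
      unfolding y_def e by (simp add: mult.assoc)
    ultimately show ?thesis
      by simp
  qed
  then show ?thesis
    by (simp add: psi_def)
qed

section \<open>The relation (4) is a congruence that centralizes the full relation\<close>

lemma congruence_swap_rel: "congruence swap_rel"
  unfolding congruence_def
proof (intro conjI allI impI)
  show "equiv UNIV swap_rel"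
    by (intro equivI refl_onI symI transI) (auto simp: swap_rel_iff_psi)
next
  fix a b c d :: 'a
  assume "(a, b) \<in> swap_rel \<and> (c, d) \<in> swap_rel"
  moreover have "psi (x * y) = psi x \<circ> psi y" for x y :: 'a
    by (simp add: psi_def fun_eq_iff mult.assoc)
  ultimately show "(a * c, b * d) \<in> swap_rel"
    by (simp add: swap_rel_iff_psi)
next
  fix a b :: 'a
  assume ab: "(a, b) \<in> swap_rel"
  have "a\<inverse> * x * b\<inverse> = b\<inverse> * x * a\<inverse>" for x
  proof -
    \<comment> \<open>The swap identity is taken at \<open>x\<inverse>\<close> and inverted.\<close>
    have "(b * x\<inverse> * a)\<inverse> = (a * x\<inverse> * b)\<inverse>"
      using swap_relD(2)[OF ab] by metis
    then show ?thesis
      by (simp add: mult.assoc)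
  qed
  with green_HD[OF swap_relD(1)[OF ab]] show "(a\<inverse>, b\<inverse>) \<in> swap_rel"
    by (simp add: swap_rel_def green_H_def)
qed

lemma congruence_refl: "congruence \<alpha> \<Longrightarrow> (x, x) \<in> \<alpha>"
  by (auto simp: congruence_def equiv_def refl_on_def)

lemma congruence_sym: "congruence \<alpha> \<Longrightarrow> (x, y) \<in> \<alpha> \<Longrightarrow> (y, x) \<in> \<alpha>"
  by (auto simp: congruence_def equiv_def dest: symD)

lemma congruence_mult:
  "congruence \<alpha> \<Longrightarrow> (a, b) \<in> \<alpha> \<Longrightarrow> (c, d) \<in> \<alpha> \<Longrightarrow> (a * c, b * d) \<in> \<alpha>"
  by (auto simp: congruence_def)

lemma congruence_sinv: "congruence \<alpha> \<Longrightarrow> (a, b) \<in> \<alpha> \<Longrightarrow> (a\<inverse>, b\<inverse>) \<in> \<alpha>"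
  by (auto simp: congruence_def)

lemma congruence_eval_sterm:
  assumes "congruence \<alpha>" "(a, b) \<in> \<alpha>"
  shows "(eval_sterm (a # us) t, eval_sterm (b # us) t) \<in> \<alpha>"
proof (induction t)
  case (Var i)
  then show ?case
    using assms by (cases i) (auto intro: congruence_refl)
qed (auto intro: assms congruence_mult congruence_sinv)

text \<open>In a product, the neighbouring subterm values are absorbed into \<open>z\<close>, so
  \<open>z\<close> must vary in the induction. Inversion reverses the order of the factors, so
  \<open>us\<close> and \<open>vs\<close> must be exchangeable.\<close>

lemma eval_sterm_swap:
  assumes "(a, b) \<in> swap_rel"
  shows "eval_sterm (a # vs) t * z * eval_sterm (b # us) t =
    eval_sterm (b # vs) t * z * eval_sterm (a # us) t"
proof (induction t arbitrary: us vs z)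
  case (Var i)
  then show ?case
    using swap_relD(2)[OF assms] by (cases i) auto
next
  case (Mult s t)
  let ?e = "\<lambda>x us. eval_sterm (x # us)"
  have "?e a vs (Mult s t) * z * ?e b us (Mult s t) =
      (?e a vs s * (?e a vs t * z) * ?e b us s) * ?e b us t"
    by (simp add: mult.assoc)
  also have "\<dots> = ?e b vs s * (?e a vs t * (z * ?e a us s) * ?e b us t)"
    unfolding Mult.IH(1) by (simp add: mult.assoc)
  also have "\<dots> = ?e b vs (Mult s t) * z * ?e a us (Mult s t)"
    unfolding Mult.IH(2) by (simp add: mult.assoc)
  finally show ?case .
next
  case (Inv t)
  have "(eval_sterm (b # us) t * z\<inverse> * eval_sterm (a # vs) t)\<inverse> =
      (eval_sterm (a # us) t * z\<inverse> * eval_sterm (b # vs) t)\<inverse>"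
    unfolding Inv.IH ..
  then show ?case
    by (simp add: mult.assoc)
qed

lemma centralizes_swap_rel: "centralizes swap_rel UNIV"
  unfolding centralizes_def term_condition_def
proof (intro allI impI)
  fix t a b us vs
  assume ab: "(a :: 'a, b) \<in> swap_rel"
    and eq: "eval_sterm (a # us) t = eval_sterm (a # vs) t"
  define w where "w = eval_sterm (a # us) t"
  have H: "(eval_sterm (a # xs) t, eval_sterm (b # xs) t) \<in> green_H" for xs
    using congruence_eval_sterm[OF congruence_swap_rel ab] by (rule swap_relD(1))
  have "eval_sterm (b # us) t = w * w\<inverse> * eval_sterm (b # us) t"
    unfolding w_def using green_H_absorb(1)[OF H] by simp
  also have "\<dots> = eval_sterm (a # vs) t * w\<inverse> * eval_sterm (b # us) t"
    by (simp add: w_def eq)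
  also have "\<dots> = eval_sterm (b # vs) t * w\<inverse> * w"
    unfolding eval_sterm_swap[OF ab] by (simp add: w_def)
  \<comment> \<open>By \<open>eq\<close>, \<open>w\<close> is also the value at
    \<open>a # vs\<close>, hence H-related to the value at \<open>b # vs\<close>.\<close>
  also have "\<dots> = eval_sterm (b # vs) t"
    using green_H_absorb(2)[OF H[of vs]] by (simp add: w_def eq mult.assoc)
  finally show "eval_sterm (b # us) t = eval_sterm (b # vs) t" .
qed

section \<open>Every congruence centralizing the full relation lies in (4)\<close>

lemma centralizes_UNIV_D:
  assumes "centralizes \<alpha> UNIV" "(a, b) \<in> \<alpha>"
    and "term_of_arity (length us + 1) t" "us \<noteq> []" "length vs = length us"
    and "eval_sterm (a # us) t = eval_sterm (a # vs) t"
  shows "eval_sterm (b # us) t = eval_sterm (b # vs) t"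
proof -
  have "length us \<ge> 1"
    using assms(4) by (cases us) auto
  then have "term_condition (length us) t \<alpha> UNIV"
    using assms(1,3) by (simp add: centralizes_def)
  with assms show ?thesis
    unfolding term_condition_def by blast
qed

lemma centralizes_right_mult:
  assumes "centralizes \<alpha> UNIV" "(a, b) \<in> \<alpha>" "a * u = a * v"
  shows "b * u = b * v"
  using centralizes_UNIV_D[OF assms(1,2), of "[u]" "Mult (Var 0) (Var 1)" "[v]"] assms(3)
  by (simp add: term_of_arity_def)

lemma centralizes_two_sided_mult:
  assumes "centralizes \<alpha> UNIV" "(a, b) \<in> \<alpha>" "u * a * u' = v * a * v'"
  shows "u * b * u' = v * b * v'"
  using centralizes_UNIV_D[OF assms(1,2), of "[u, u']" "Mult (Mult (Var 1) (Var 0)) (Var 2)"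
      "[v, v']"] assms(3)
  by (simp add: term_of_arity_def)

text \<open>For related idempotents \<open>p\<close> and \<open>q\<close>, \<open>p * q\<close> is
  related to \<open>p\<close>, and it has the same product with \<open>p\<close> as with
  \<open>p * q\<close>. The term condition carries this over to the multiplier \<open>p\<close>,
  giving \<open>p = p * q\<close>; the roles of \<open>p\<close> and \<open>q\<close> are
  symmetric.\<close>

lemma centralizes_idem_eq:
  assumes "congruence \<alpha>" "centralizes \<alpha> UNIV" "(e, f) \<in> \<alpha>" "e * e = e" "f * f = f"
  shows "e = f"
proof -
  have le: "p = p * q" if "(p, q) \<in> \<alpha>" "p * p = p" "q * q = q" for p q :: 'a
  proof -
    have "(p * p, p * q) \<in> \<alpha>"
      using assms(1) that(1) by (intro congruence_mult) (auto intro: congruence_refl)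
    then have "(p * q, p) \<in> \<alpha>"
      using assms(1) that(2) by (auto intro: congruence_sym)
    moreover have "p * q * p = p * q * (p * q)"
      using that(2,3) idem_commute[OF that(2,3)] by (metis mult.assoc)
    ultimately have "p * p = p * (p * q)"
      by (rule centralizes_right_mult[OF assms(2)])
    with that(2) show ?thesis
      by (metis mult.assoc)
  qed
  show ?thesis
    using le[OF assms(3-5)] le[OF congruence_sym[OF assms(1,3)] assms(5,4)]
      idem_commute[OF assms(4,5)] by simp
qed

lemma centralizes_subset_swap_rel:
  assumes "congruence \<alpha>" "centralizes \<alpha> UNIV"
  shows "\<alpha> \<subseteq> swap_rel"
proof (rule subrelI)
  fix a b assume ab: "(a, b) \<in> \<alpha>"
  have "a\<inverse> * a = b\<inverse> * b"
    using assms(1) ab by (intro centralizes_idem_eq[OF assms _ sinv_mult_idem sinv_mult_idem]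
        congruence_mult congruence_sinv)
  moreover have "a * a\<inverse> = b * b\<inverse>"
    using assms(1) ab by (intro centralizes_idem_eq[OF assms _ mult_sinv_idem mult_sinv_idem]
        congruence_mult congruence_sinv)
  ultimately have H: "(a, b) \<in> green_H"
    by (simp add: green_H_def)
  have "a * x * b = b * x * a" for x
  proof -
    \<comment> \<open>Both sides equal \<open>a * x * a\<close>, but the \<open>a\<close> to be
      replaced by \<open>b\<close> is the last one on the left and the first one on the right; the
      idempotents fill the empty outer places.\<close>
    have "a * x * a * (a\<inverse> * a) = a * a\<inverse> * a * (x * a)"
      by (simp add: mult.assoc)
    then have "a * x * b * (a\<inverse> * a) = a * a\<inverse> * b * (x * a)"
      by (rule centralizes_two_sided_mult[OF assms(2) ab])
    then have "a * x * (b * (a\<inverse> * a)) = b * x * a"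
      unfolding green_H_absorb(1)[OF H] by (simp only: mult.assoc)
    then show ?thesis
      unfolding green_H_absorb(2)[OF H] .
  qed
  with H show "(a, b) \<in> swap_rel"
    by (simp add: swap_rel_def)
qed

section \<open>The congruence pair\<close>

text \<open>With \<open>e = a\<inverse> * a\<close> and \<open>f = a * a\<inverse>\<close>, the
  defining identity at \<open>x = e\<close> gives \<open>a = e * a\<close> and at
  \<open>x = f\<close> gives \<open>a = a * f\<close>; hence both idempotents equal
  \<open>e * f\<close>.\<close>

lemma Z_set_sinv_commute:
  assumes "a \<in> Z_set"
  shows "a\<inverse> * a = a * a\<inverse>"
proof -
  define e f where "e = a\<inverse> * a" and "f = a * a\<inverse>"
  have e: "e * e = e" and f: "f * f = f"
    unfolding e_def f_def by (rule sinv_mult_idem, rule mult_sinv_idem)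
  have ae: "a * e = a" and fa: "f * a = a"
    by (simp_all add: e_def f_def mult.assoc)
  have Z: "a * x * e = f * x * a" for x
    using assms by (simp add: Z_set_def e_def f_def mult.assoc)
  have ef: "e * f = f * e"
    by (rule idem_commute[OF e f])
  have "a = e * a"
    using Z[of e] ae fa ef by (metis mult.assoc)
  then have "f = e * f"
    unfolding f_def by (metis mult.assoc)
  moreover have "a = a * f"
    using Z[of f] ae f fa ef by (metis mult.assoc)
  then have "e = e * f"
    unfolding e_def by (metis mult.assoc)
  ultimately show ?thesis
    unfolding e_def[symmetric] f_def[symmetric] by simp
qed

text \<open>Once \<open>a\<inverse> * a\<close> and \<open>a * a\<inverse>\<close> coincide, the
  identity defining \<open>Z_set\<close> is the swap identity between \<open>a\<close> and that
  idempotent. Conversely, an idempotent H-related to \<open>a\<close> equals both of them.\<close>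

lemma Z_set_iff: "a \<in> Z_set \<longleftrightarrow> (\<exists>e\<in>idempotents. (a, e) \<in> swap_rel)"
proof
  assume a: "a \<in> Z_set"
  let ?e = "a\<inverse> * a"
  note comm = Z_set_sinv_commute[OF a]
  have "(a, ?e) \<in> green_H"
    using comm by (simp add: green_H_def mult.assoc)
  moreover have "a * x * ?e = ?e * x * a" for x
    using a comm by (simp add: Z_set_def mult.assoc)
  ultimately have "(a, ?e) \<in> swap_rel"
    by (simp add: swap_rel_def)
  then show "\<exists>e\<in>idempotents. (a, e) \<in> swap_rel"
    using sinv_mult_idem[of a] by (auto simp: idempotents_def)
next
  assume "\<exists>e\<in>idempotents. (a, e) \<in> swap_rel"
  then obtain e where e: "e * e = e" and ae: "(a, e) \<in> swap_rel"
    by (auto simp: idempotents_def)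
  have "a\<inverse> * a = e" "a * a\<inverse> = e"
    using green_HD[OF swap_relD(1)[OF ae]] e by (simp_all add: sinv_idem)
  then have "a * x * (a\<inverse> * a) = a * a\<inverse> * x * a" for x
    by (simp only: swap_relD(2)[OF ae])
  then show "a \<in> Z_set"
    by (simp add: Z_set_def mult.assoc)
qed

lemma congruence_kernel_eq:
  assumes "congruence \<alpha>"
  shows "congruence_kernel \<alpha> = {a. \<exists>e\<in>idempotents. (a, e) \<in> \<alpha>}"
proof -
  have equiv: "equiv UNIV \<alpha>"
    using assms by (simp add: congruence_def)
  then have "congruence_kernel \<alpha> = {a. \<alpha> `` {a} \<inter> idempotents \<noteq> {}}"
    unfolding congruence_kernel_def
    by (auto simp: quotient_def dest: equiv_class_eq
        intro: congruence_refl[OF assms])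
  then show ?thesis
    by auto
qed

text \<open>Each H-class contains at most one idempotent.\<close>

lemma congruence_trace_swap_rel: "congruence_trace swap_rel = Id_on idempotents"
  using congruence_refl[OF congruence_swap_rel]
  by (auto simp: congruence_trace_def idempotents_def dest: swap_relD(1) green_H_idem_eq)

theorem theorem1p2:
  "\<exists>\<zeta> :: ('a::inverse_semigroup) rel.
     is_center \<zeta> \<and>
     \<zeta> = map_kernel psi \<and>
     \<zeta> = map_kernel phi \<and>
     \<zeta> = green_H \<inter> {(a, b). \<forall>x. a * x * b = b * x * a} \<and>
     congruence_pair \<zeta> = (Z_set, Id_on idempotents)"
proof (intro exI conjI)
  show "is_center swap_rel"
    unfolding is_center_def
    using congruence_swap_rel centralizes_swap_rel centralizes_subset_swap_rel by blast
  show "swap_rel = map_kernel psi"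
    by (auto simp: map_kernel_def swap_rel_iff_psi)
  show "swap_rel = map_kernel phi"
    by (auto simp: map_kernel_def swap_rel_iff_psi intro: psi_eq_phi_eq phi_eq_psi_eq)
  show "swap_rel = green_H \<inter> {(a, b). \<forall>x. a * x * b = b * x * a}"
    by (rule swap_rel_def)
  show "congruence_pair swap_rel = (Z_set, Id_on idempotents)"
    unfolding congruence_pair_def congruence_trace_swap_rel
      congruence_kernel_eq[OF congruence_swap_rel]
    using Z_set_iff by auto
qed

end
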